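(* Let $\mathcal{G}=(V,D,B)$ be a mixed graph with $V=\{1,\dots,p\}$, and let $C_1,\dots,C_l$ be the vertex sets of the connected components of its bidirected part $\mathcal{G}_\leftrightarrow=(V,\emptyset,B)$. Then \[ \tau(\mathcal{G}) \;=\; \max_{j=1,\dots,l} |\mathrm{Pa}(C_j)|. \] Moreover, if $n<\tau(\mathcal{G})$, then $\hat\ell(\mathcal{G}\mid S_{0,n})=\infty$ almost surely.
   Context: A mixed graph is a triple $\mathcal{G}=(V,D,B)$ with $V=\{1,\dots,p\}$, $D\subseteq V\times V$ a set of directed edges $i\to j$ (with no self-loops $i\to i$), and $B$ a set of 2-element subsets $\{i,j\}$ of $V$ (bidirected edges $i\leftrightarrow j$). Nodes $i,j$ are adjacent if $i\leftrightarrow j\in B$, $i\to j\in D$ or $j\to i\in D$; connectivity and connected components are with respect to this adjacency (a path uses edges of any type, ignoring orientation). Let $\mathrm{pa}(j)=\{k\in V: k\to j\in D\}$ and, for $A\subseteq V$, $\mathrm{Pa}(A)=A\cup\bigcup_{i\in A}\mathrm{pa}(i)$. Let $\mathbb{R}^D$ be the set of real $p\times p$ matrices $\Lambda=(\lambda_{ij})$ with $\lambda_{ij}=0$ whenever $i\to j\notin D$ (in particular zero diagonal), and $\mathbb{R}^D_{\mathrm{reg}}=\{\Lambda\in\mathbb{R}^D: I-\Lambda \text{ invertible}\}$. Let $PD(B)$ be the set of positive definite $p\times p$ matrices $\Omega=(\omega_{ij})$ with $\omega_{ij}=0$ whenever $i\ne j$ and $\{i,j\}\notin B$. Define $PD(\mathcal{G})=\{(I-\Lambda)^{-T}\Omega(I-\Lambda)^{-1}: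 \Lambda\in\mathbb{R}^D_{\mathrm{reg}},\ \Omega\in PD(B)\}$. For a sample $X^{(1)},\dots,X^{(n)}$ of i.i.d. random vectors in $\mathbb{R}^p$ drawn from an absolutely continuous distribution (e.g. a nondegenerate multivariate normal), let $S_{0,n}=\frac1n\sum_{s=1}^n X^{(s)}(X^{(s)})^T$. For positive definite $\Sigma$ let $\ell(\Sigma\mid S)=-\log\det\Sigma-\mathrm{trace}(\Sigma^{-1}S)$ and $\hat\ell(\mathcal{G}\mid S)=\sup\{\ell(\Sigma\mid S):\Sigma\in PD(\mathcal{G})\}$. "Almost surely" (a.s.) refers to this sampling distribution. The maximum likelihood threshold is $\tau(\mathcal{G})=\min\{N\in\mathbb{N}: \hat\ell(\mathcal{G}\mid S_{0,n})<\infty \text{ a.s. for all } n\ge N\}$. *)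

theory Defs
  imports "HOL-Analysis.Analysis" "HOL-Probability.Probability"
begin

text \<open>Vertices are the elements of a finite type 'n (playing the role of V = {1..p},
  p = CARD('n)). Directed edges D :: ('n \<times> 'n) set, (i,j) \<in> D meaning i \<rightarrow> j;
  bidirected edges B :: 'n set set, each a 2-element set.\<close>

definition pa :: "('n \<times> 'n) set \<Rightarrow> 'n \<Rightarrow> 'n set" where
  "pa D j = {k. (k, j) \<in> D}"

definition Pa :: "('n \<times> 'n) set \<Rightarrow> 'n set \<Rightarrow> 'n set" where
  "Pa D A = A \<union> (\<Union>i\<in>A. pa D i)"

definition bidi_rel :: "'n set set \<Rightarrow> ('n \<times> 'n) set" where
  "bidi_rel B = {(i, j). {i, j} \<in> B}"

definition bidi_components :: "'n set set \<Rightarrow> 'n set set" where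
  "bidi_components B = {{j. (i, j) \<in> (bidi_rel B)\<^sup>*} | i. True}"

definition pos_def :: "real^'n^'n \<Rightarrow> bool" where
  "pos_def M \<longleftrightarrow> transpose M = M \<and> (\<forall>x. x \<noteq> 0 \<longrightarrow> x \<bullet> (M *v x) > 0)"

definition RD_reg :: "('n \<times> 'n) set \<Rightarrow> (real^'n^'n) set" where
  "RD_reg D = {L. (\<forall>i j. (i, j) \<notin> D \<longrightarrow> L $ i $ j = 0) \<and> invertible (mat 1 - L)}"

definition PD_B :: "'n set set \<Rightarrow> (real^'n^'n) set" where
  "PD_B B = {W. pos_def W \<and> (\<forall>i j. i \<noteq> j \<and> {i, j} \<notin> B \<longrightarrow> W $ i $ j = 0)}"

definition PD_G :: "('n \<times> 'n) set \<Rightarrow> 'n set set \<Rightarrow> (real^'n^'n) set" where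
  "PD_G D B = {transpose (matrix_inv (mat 1 - L)) ** W ** matrix_inv (mat 1 - L)
                 | L W. L \<in> RD_reg D \<and> W \<in> PD_B B}"

definition loglik :: "real^'n^'n \<Rightarrow> real^'n^'n \<Rightarrow> real" where
  "loglik Sig S = - ln (det Sig) - trace (matrix_inv Sig ** S)"

definition lhat :: "('n \<times> 'n) set \<Rightarrow> 'n set set \<Rightarrow> real^'n^'n \<Rightarrow> ereal" where
  "lhat D B S = (SUP Sig \<in> PD_G D B. ereal (loglik Sig S))"

definition S0 :: "nat \<Rightarrow> (nat \<Rightarrow> real^'n) \<Rightarrow> real^'n^'n" where
  "S0 n X = (1 / real n) *\<^sub>R (\<Sum>s<n. (\<chi> i j. X s $ i * X s $ j))"

abbreviation sample_space :: "nat \<Rightarrow> (real^'n) measure \<Rightarrow> (nat \<Rightarrow> real^'n) measure" where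
  "sample_space n P \<equiv> PiM {..<n} (\<lambda>_. P)"

definition mlt :: "('n \<times> 'n) set \<Rightarrow> 'n set set \<Rightarrow> (real^'n) measure \<Rightarrow> nat" where
  "mlt D B P = (LEAST N. \<forall>n\<ge>N. AE X in sample_space n P. lhat D B (S0 n X) < \<infinity>)"

end

theory Submission
  imports Defs
begin

text \<open>
  Write $A = I - \Lambda$, so that $\Sigma^{-1} = A \Omega^{-1} A^T$. Since $\Omega^{-1}$ is block
  diagonal along the bidirected components, $x^T \Sigma^{-1} x$ is a sum of positive semidefinite
  forms $q_C$, where $q_C$ only sees the coordinates of $x$ in $\mathrm{Pa}(C)$.

  If $n \ge |\mathrm{Pa}(C)|$ for all $C$, then almost surely the sample restricted to
  $\mathrm{Pa}(C)$ spans $\mathbb{R}^{\mathrm{Pa}(C)}$. Hence the trace of $\Sigma^{-1}$ is at most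
  a constant times the trace of $\Sigma^{-1} S$, and as $\det \Sigma^{-1}$ is polynomially bounded in
  the trace, the log-likelihood is bounded above.

  If $n < |\mathrm{Pa}(C)|$ for some $C$, then almost surely there is a vector $v$ supported on
  $\mathrm{Pa}(C)$, orthogonal to the sample, with nonzero coordinates on $C$. For $u = v|_C$, one
  can choose $\Lambda$ with $A u = v$, because each node of $\mathrm{Pa}(C) - C$ has a child in $C$.
  The transformed sample points $A^T X^{(s)}$ are then orthogonal to $u$. As $C$ is connected by
  bidirected edges, there is a singular $\Omega_0$ with the right zero pattern and kernel spanned by
  $u$. Along $\Omega_0 + \varepsilon I$ the determinant tends to $0$ while the trace term stays
  bounded.
\<close>

section \<open>Almost sure statements about independent samples\<close>

lemma AE_hyperplane:
  fixes P :: "(real^'n::finite) measure"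
  assumes "sets P = sets borel" "absolutely_continuous lborel P" "w \<noteq> 0"
  shows "AE x in P. w \<bullet> x \<noteq> 0"
proof -
  have "negligible {x. w \<bullet> x = 0}"
    using assms(3) by (intro negligible_hyperplane) auto
  moreover have "{x. w \<bullet> x = 0} \<in> sets borel"
    by measurable
  ultimately have "{x. w \<bullet> x = 0} \<in> null_sets lborel"
    by (simp add: negligible_iff_null_sets null_sets_completion_iff)
  then have "{x. w \<bullet> x = 0} \<in> null_sets P"
    using assms(2) by (auto simp: absolutely_continuous_def)
  then show ?thesis
    by (rule AE_I'[of _ P]) auto
qed

text \<open>Fubini's theorem in the form used for inductions over the sample size: the first
  \<open>n\<close> points are frozen, and an exceptional null set is then allowed for the last point
  alone.\<close>

lemma AE_sample_space_Suc:
  assumes P: "prob_space P"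
    and meas: "{X \<in> space (sample_space (Suc n) P). Q X} \<in> sets (sample_space (Suc n) P)"
    and ae: "AE X in sample_space n P. AE x in P. Q (X(n := x))"
  shows "AE X in sample_space (Suc n) P. Q X"
proof -
  let ?M = "sample_space n P"
  interpret P: prob_space P by fact
  interpret M: prob_space ?M
    by (intro prob_space_PiM P)
  have eq: "distr (P \<Otimes>\<^sub>M ?M) (sample_space (Suc n) P) (\<lambda>(x, X). X(n := x)) = sample_space (Suc n) P"
    using distr_pair_PiM_eq_PiM[of "{..<n}" "\<lambda>_. P" n] P by (simp add: lessThan_Suc)
  have [measurable]: "(\<lambda>(x, X). X(n := x)) \<in> P \<Otimes>\<^sub>M ?M \<rightarrow>\<^sub>M sample_space (Suc n) P"
    unfolding lessThan_Suc by measurable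
  have [measurable]: "Measurable.pred (sample_space (Suc n) P) Q"
    using meas by (simp add: pred_def)
  interpret MP: pair_sigma_finite ?M P ..
  have "AE z in ?M \<Otimes>\<^sub>M P. Q ((fst z)(n := snd z))"
  proof (rule MP.AE_pair_measure)
    have "(\<lambda>z. (fst z)(n := snd z)) \<in> ?M \<Otimes>\<^sub>M P \<rightarrow>\<^sub>M sample_space (Suc n) P"
      unfolding lessThan_Suc by measurable
    then show "{z \<in> space (?M \<Otimes>\<^sub>M P). Q ((fst z)(n := snd z))} \<in> sets (?M \<Otimes>\<^sub>M P)"
      by measurable
  qed (use ae in simp)
  \<comment> \<open>The factors are swapped because the iterated statement freezes the old points
    first, whereas the product decomposition \<open>eq\<close> lists the new point first.\<close>
  then have "AE z in distr (P \<Otimes>\<^sub>M ?M) (?M \<Otimes>\<^sub>M P) (\<lambda>(x, y). (y, x)). Q ((fst z)(n := snd z))"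
    by (simp only: MP.distr_pair_swap[symmetric])
  then have "AE z in P \<Otimes>\<^sub>M ?M. Q ((\<lambda>(x, X). X(n := x)) z)"
    by (auto dest!: AE_distrD[rotated] simp: split_beta)
  then have "AE X in distr (P \<Otimes>\<^sub>M ?M) (sample_space (Suc n) P) (\<lambda>(x, X). X(n := x)). Q X"
    using meas by (subst AE_distr_iff) auto
  then show ?thesis
    by (simp only: eq)
qed

text \<open>The law of the first \<open>m\<close> points is the marginal of the law of all
  \<open>n\<close>, so statements about a short initial sample carry over to a longer one.\<close>

lemma AE_sample_space_restrict:
  assumes P: "prob_space P" and "m \<le> n"
    and "AE X in sample_space m P. Q X"
  shows "AE X in sample_space n P. Q (restrict X {..<m})"
proof -
  interpret product_prob_space "\<lambda>_. P" "{..<n}"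
    using P by (simp add: product_prob_space_def product_prob_space_axioms_def
        product_sigma_finite_def prob_space_imp_sigma_finite)
  have "sample_space m P = distr (sample_space n P) (sample_space m P) (\<lambda>f. restrict f {..<m})"
    using \<open>m \<le> n\<close> by (intro distr_restrict) auto
  then have "AE X in distr (sample_space n P) (sample_space m P) (\<lambda>f. restrict f {..<m}). Q X"
    using assms(3) by (rule subst)
  then show ?thesis
    by (rule AE_distrD[of "\<lambda>f. restrict f {..<m}" _ "sample_space m P" Q, rotated])
      (use \<open>m \<le> n\<close> in \<open>auto intro!: measurable_restrict_subset\<close>)
qed

text \<open>
  The vector $v(X)$ solves $n$ generic linear equations in $n$ unknowns whose right-hand sides may
  depend on the sample. Passing from $n$ to $n+1$, a vector $w \neq 0$ orthogonal to the first $n$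
  sample points is almost surely not orthogonal to the next one; it corrects the last equation.
\<close>

lemma AE_interpolation:
  fixes P :: "(real^'n::finite) measure" and \<beta> :: "nat \<Rightarrow> real^'n \<Rightarrow> real"
  assumes P: "prob_space P" and [measurable_cong]: "sets P = sets borel"
    and ac: "absolutely_continuous lborel P"
    and "card A = n" and "\<And>s. \<beta> s \<in> borel_measurable borel"
  shows "\<exists>v \<in> borel_measurable (sample_space n P).
    (\<forall>X. \<forall>i. i \<notin> A \<longrightarrow> v X $ i = 0) \<and>
    (AE X in sample_space n P. \<forall>s<n. v X \<bullet> X s = \<beta> s (X s))"
  using assms(4,5)
proof (induction n arbitrary: A \<beta>)
  case 0
  show ?case by (intro bexI[of _ "\<lambda>_. 0"]) auto
next
  case (Suc n)
  note [measurable] = Suc.prems(2)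
  let ?M = "sample_space n P" and ?M' = "sample_space (Suc n) P"
  let ?r = "\<lambda>X. restrict X {..<n}"
  obtain i where i: "i \<in> A" using Suc.prems(1) by (metis card_eq_SucD insertI1)
  have card: "card (A - {i}) = n" using Suc.prems(1) i by simp
  obtain v where v [measurable]: "v \<in> borel_measurable ?M"
    and v_IH: "(\<forall>X j. j \<notin> A - {i} \<longrightarrow> v X $ j = 0) \<and>
      (AE X in ?M. \<forall>s<n. v X \<bullet> X s = \<beta> s (X s))"
    by (rule bexE[OF Suc.IH[OF card, of \<beta>, OF Suc.prems(2)]]) (rule that)
  have m: "(\<lambda>x :: real^'n. - (x $ i)) \<in> borel_measurable borel"
    by (intro borel_measurable_continuous_onI continuous_intros)
  \<comment> \<open>The second use of the induction hypothesis prescribes \<open>- (x $ i)\<close>,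
    so that \<open>axis i 1 + w' X\<close> is orthogonal to the first \<open>n\<close> points. As
    \<open>w' X\<close> vanishes at \<open>i\<close>, this sum has coordinate 1 there and cannot be
    0.\<close>
  obtain w' where w' [measurable]: "w' \<in> borel_measurable ?M"
    and w'_IH: "(\<forall>X j. j \<notin> A - {i} \<longrightarrow> w' X $ j = 0) \<and>
      (AE X in ?M. \<forall>s<n. w' X \<bullet> X s = - (X s $ i))"
    by (rule bexE[OF Suc.IH[OF card, of "\<lambda>_ x. - (x $ i)", OF m]]) (rule that)
  note v0 = v_IH[THEN conjunct1, rule_format] and vX = v_IH[THEN conjunct2]
    and w'0 = w'_IH[THEN conjunct1, rule_format] and w'X = w'_IH[THEN conjunct2]
  define w where "w = (\<lambda>X. axis i 1 + w' X)"
  have w [measurable]: "w \<in> borel_measurable ?M" unfolding w_def by measurable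
  have wX: "AE X in ?M. \<forall>s<n. w X \<bullet> X s = 0"
    using w'X by eventually_elim (simp add: w_def inner_add_left inner_axis')
  have w_nz: "w X \<noteq> 0" for X
  proof
    assume "w X = 0"
    then have "w X $ i = 0" by simp
    then show False using w'0[of i X] by (simp add: w_def axis_def)
  qed
  have [measurable]: "?r \<in> ?M' \<rightarrow>\<^sub>M ?M"
    by (rule measurable_restrict_subset) auto
  have [measurable]: "(\<lambda>X. X n) \<in> borel_measurable ?M'"
    by measurable
  \<comment> \<open>Adding a multiple of \<open>w\<close> leaves the first \<open>n\<close>
    equations intact; the coefficient is the one that solves the equation for the point with index
    \<open>n\<close>.\<close>
  define u where "u = (\<lambda>X. v (?r X) +
    ((\<beta> n (X n) - v (?r X) \<bullet> X n) / (w (?r X) \<bullet> X n)) *\<^sub>R w (?r X))"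
  have "AE X in ?M'. w (?r X) \<bullet> X n \<noteq> 0"
  proof (rule AE_sample_space_Suc[OF P])
    \<comment> \<open>This is what the measurability clause in the induction hypothesis is
      for.\<close>
    show "{X \<in> space ?M'. w (?r X) \<bullet> X n \<noteq> 0} \<in> sets ?M'"
      by measurable
    have "?r (X(n := x)) = X" if "X \<in> space ?M" for X x
      using that by (auto simp: space_PiM PiE_def extensional_def restrict_def)
    then show "AE X in ?M. AE x in P. w (?r (X(n := x))) \<bullet> (X(n := x)) n \<noteq> 0"
      using AE_hyperplane[OF assms(2) ac w_nz] by (intro AE_I2[of ?M]) simp
  qed
  moreover have "AE X in ?M'. \<forall>s<n. v (?r X) \<bullet> ?r X s = \<beta> s (?r X s)"
    by (rule AE_sample_space_restrict[OF P _ vX]) simp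
  moreover have "AE X in ?M'. \<forall>s<n. w (?r X) \<bullet> ?r X s = 0"
    by (rule AE_sample_space_restrict[OF P _ wX]) simp
  ultimately have "AE X in ?M'. \<forall>s<Suc n. u X \<bullet> X s = \<beta> s (X s)"
    by eventually_elim (auto simp: u_def inner_add_left less_Suc_eq)
  moreover have "u \<in> borel_measurable ?M'"
    unfolding u_def by measurable
  moreover have "u X $ j = 0" if "j \<notin> A" for X j
    using that v0[of j] w'0[of j] i by (auto simp: u_def w_def axis_def)
  ultimately show ?case by (intro bexI[of _ u] conjI) auto
qed

section \<open>Generic position of the sample in coordinate subspaces\<close>

definition coord_proj :: "'n set \<Rightarrow> real^'n \<Rightarrow> real^'n::finite" where
  "coord_proj A x = (\<chi> i. if i \<in> A then x $ i else 0)"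

lemma inner_coord_proj:
  assumes "\<And>i. i \<notin> A \<Longrightarrow> v $ i = 0"
  shows "v \<bullet> coord_proj A x = v \<bullet> x"
  using assms by (auto simp: inner_vec_def coord_proj_def intro!: sum.cong)

text \<open>A dual family forces the projected points to be distinct and linearly independent, and
  \<open>m\<close> independent vectors in a space of dimension at most \<open>m\<close> span
  it.\<close>

lemma span_coord_proj_of_dual:
  fixes x :: "nat \<Rightarrow> real^'n::finite"
  assumes "card A = m"
    and v0: "\<And>t i. i \<notin> A \<Longrightarrow> v t $ i = 0"
    and dual: "\<And>s t. s < m \<Longrightarrow> t < m \<Longrightarrow> v t \<bullet> x s = (if s = t then 1 else 0)"
    and y: "\<And>i. i \<notin> A \<Longrightarrow> y $ i = 0"
  shows "y \<in> span ((\<lambda>s. coord_proj A (x s)) ` {..<m})"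
proof -
  let ?g = "\<lambda>s. coord_proj A (x s)"
  let ?V = "{z :: real^'n. \<forall>i. i \<notin> A \<longrightarrow> z $ i = 0}"
  have d: "v t \<bullet> ?g s = (if s = t then 1 else 0)" if "s < m" "t < m" for s t
    using dual[OF that] inner_coord_proj[of A "v t" "x s"] v0 by simp
  have inj: "inj_on ?g {..<m}"
    by (rule inj_onI) (metis d lessThan_iff zero_neq_one)
  have "independent (?g ` {..<m})"
  proof (rule independent_if_scalars_zero)
    fix f z assume sum0: "(\<Sum>z\<in>?g ` {..<m}. f z *\<^sub>R z) = 0" and "z \<in> ?g ` {..<m}"
    then obtain t where t: "t < m" "z = ?g t" by auto
    have "0 = v t \<bullet> (\<Sum>s<m. f (?g s) *\<^sub>R ?g s)"
      using sum0 by (simp add: sum.reindex[OF inj])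
    also have "\<dots> = (\<Sum>s<m. if s = t then f (?g s) else 0)"
      unfolding inner_sum_right by (rule sum.cong) (auto simp: d t)
    also have "\<dots> = f z"
      using t by simp
    finally show "f z = 0" by simp
  qed simp
  moreover have "?g ` {..<m} \<subseteq> ?V"
    by (auto simp: coord_proj_def)
  moreover have "dim ?V \<le> card (?g ` {..<m})"
  proof -
    have "z \<in> span ((\<lambda>i. axis i 1) ` A)" if "z \<in> ?V" for z :: "real^'n"
    proof -
      have "z = (\<Sum>i\<in>A. z $ i *\<^sub>R axis i 1)"
        using that by (auto simp: vec_eq_iff axis_def if_distrib[of "\<lambda>c. _ * c"] cong: if_cong)
      also have "\<dots> \<in> span ((\<lambda>i. axis i 1) ` A)"
        by (intro span_sum span_scale span_base) auto
      finally show ?thesis .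
    qed
    then have "dim ?V \<le> card ((\<lambda>i. axis i (1::real)) ` A)"
      by (intro dim_le_card) auto
    also have "\<dots> \<le> card A"
      by (rule card_image_le) simp
    also have "\<dots> = card (?g ` {..<m})"
      using assms(1) by (simp add: card_image[OF inj])
    finally show ?thesis .
  qed
  ultimately have "?V \<subseteq> span (?g ` {..<m})"
    using card_ge_dim_independent by blast
  then show ?thesis
    using y by auto
qed

text \<open>The first \<open>card A\<close> points already suffice: interpolation with Kronecker
  delta right-hand sides yields a dual family supported on \<open>A\<close>. Further points can only
  enlarge the span.\<close>

lemma AE_coord_proj_spans:
  fixes P :: "(real^'n::finite) measure"
  assumes P: "prob_space P" and "sets P = sets borel" "absolutely_continuous lborel P"
    and "card A \<le> n"
  shows "AE X in sample_space n P. \<forall>y. (\<forall>i. i \<notin> A \<longrightarrow> y $ i = 0) \<longrightarrow>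
    y \<in> span ((\<lambda>s. coord_proj A (X s)) ` {..<n})"
proof -
  define m where "m = card A"
  have "\<forall>t. \<exists>v. (\<forall>X i. i \<notin> A \<longrightarrow> v X $ i = 0) \<and>
      (AE X in sample_space m P. \<forall>s<m. v X \<bullet> X s = (if s = t then 1 else 0))"
    by (rule allI, rule bexE[OF AE_interpolation[OF assms(1-3) m_def[symmetric],
        of "\<lambda>s _. if s = t then 1 else 0" for t, OF borel_measurable_const]], erule exI)
  from choice[OF this] obtain v where v: "\<forall>t. (\<forall>X i. i \<notin> A \<longrightarrow> v t X $ i = 0) \<and>
      (AE X in sample_space m P. \<forall>s<m. v t X \<bullet> X s = (if s = t then 1 else 0))"
    by (rule exE)
  have v0: "\<And>t X i. i \<notin> A \<Longrightarrow> v t X $ i = 0"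
    using v by blast
  have vX: "\<And>t. AE X in sample_space m P. \<forall>s<m. v t X \<bullet> X s = (if s = t then 1 else 0)"
    by (rule v[rule_format, THEN conjunct2])
  \<comment> \<open>The index \<open>t\<close> runs over a countable type, so the exceptional null
    sets for the single \<open>t\<close> can be united.\<close>
  have "AE X in sample_space m P. \<forall>t. \<forall>s<m. v t X \<bullet> X s = (if s = t then 1 else 0)"
    using vX by (simp add: AE_all_countable)
  then have "AE X in sample_space n P. \<forall>t. \<forall>s<m. v t (restrict X {..<m}) \<bullet> restrict X {..<m} s
      = (if s = t then 1 else 0)"
    using assms(4) by (intro AE_sample_space_restrict[OF P]) (auto simp: m_def)
  then show ?thesis
  proof eventually_elim
    case (elim X)
    show ?case
    proof (intro allI impI)
      fix y :: "real^'n" assume y: "\<forall>i. i \<notin> A \<longrightarrow> y $ i = 0"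
      have "y \<in> span ((\<lambda>s. coord_proj A (X s)) ` {..<m})"
        using elim y
        by (intro span_coord_proj_of_dual[where v="\<lambda>t. v t (restrict X {..<m})"])
          (auto simp: m_def v0)
      moreover have "span ((\<lambda>s. coord_proj A (X s)) ` {..<m}) \<subseteq> span ((\<lambda>s. coord_proj A (X s)) ` {..<n})"
        using assms(4) by (intro span_mono image_mono) (auto simp: m_def)
      ultimately show "y \<in> span ((\<lambda>s. coord_proj A (X s)) ` {..<n})"
        by blast
    qed
  qed
qed

text \<open>Coordinates are treated one at a time: for given \<open>v\<close> and \<open>w\<close>,
  all but finitely many combinations \<open>v + t *\<^sub>R w\<close> avoid every zero that has to
  be avoided.\<close>

lemma subspace_common_nonzero:
  fixes V :: "(real^'n::finite) set"
  assumes V: "subspace V" and "\<And>i. i \<in> C \<Longrightarrow> \<exists>v\<in>V. v $ i \<noteq> 0"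
  shows "\<exists>v\<in>V. \<forall>i\<in>C. v $ i \<noteq> 0"
proof -
  have "finite C" by simp
  then show ?thesis using assms(2)
  proof (induction C)
    case empty
    then show ?case using subspace_0[OF V] by auto
  next
    case (insert j C)
    obtain v where v: "v \<in> V" "\<And>i. i \<in> C \<Longrightarrow> v $ i \<noteq> 0" using insert by auto
    obtain w where w: "w \<in> V" "w $ j \<noteq> 0" using insert.prems by auto
    \<comment> \<open>Where \<open>w $ i = 0\<close> the excluded value is the harmless default 0.
      Such an \<open>i\<close> differs from \<open>j\<close>, hence lies in \<open>C\<close>, and
      \<open>v $ i\<close> is already nonzero.\<close>
    have "finite ((\<lambda>i. - (v $ i) / w $ i) ` insert j C)" by simp
    then obtain t where t: "t \<notin> (\<lambda>i. - (v $ i) / w $ i) ` insert j C"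
      using ex_new_if_finite[OF infinite_UNIV_char_0] by blast
    have "(v + t *\<^sub>R w) $ i \<noteq> 0" if "i \<in> insert j C" for i
    proof
      assume z: "(v + t *\<^sub>R w) $ i = 0"
      show False
      proof (cases "w $ i = 0")
        case True
        with z have "v $ i = 0" by simp
        moreover have "i \<in> C" using that True w by auto
        ultimately show False using v by blast
      next
        case False
        with z have "t = - (v $ i) / w $ i" by (simp add: field_simps)
        then show False using t that by blast
      qed
    qed
    moreover have "v + t *\<^sub>R w \<in> V"
      using V v w by (simp add: subspace_add subspace_scale)
    ultimately show ?case by blast
  qed
qed

lemma AE_orthogonal_vector:
  fixes P :: "(real^'n::finite) measure"
  assumes P: "prob_space P" and "sets P = sets borel" "absolutely_continuous lborel P"
    and "C \<subseteq> A" "n < card A"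
  shows "AE X in sample_space n P. \<exists>v. (\<forall>i. i \<notin> A \<longrightarrow> v $ i = 0) \<and>
    (\<forall>s<n. v \<bullet> X s = 0) \<and> (\<forall>i\<in>C. v $ i \<noteq> 0)"
proof -
  have "AE X in sample_space n P. \<exists>v. (\<forall>i. i \<notin> A \<longrightarrow> v $ i = 0) \<and>
    (\<forall>s<n. v \<bullet> X s = 0) \<and> v $ j \<noteq> 0" if "j \<in> C" for j
  proof -
    \<comment> \<open>Coordinate \<open>j\<close> is fixed to 1, and the \<open>n\<close>
      orthogonality conditions are solved in \<open>n\<close> unknowns taken from the rest of
      \<open>A\<close>. This is where \<open>n < card A\<close> enters.\<close>
    have "n \<le> card (A - {j})" using assms(4,5) that by (simp add: subset_iff)
    then obtain A' where A': "A' \<subseteq> A - {j}" "card A' = n"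
      by (meson obtain_subset_with_card_n)
    then have "j \<notin> A'" by blast
    have m: "(\<lambda>x :: real^'n. - (x $ j)) \<in> borel_measurable borel"
      by (intro borel_measurable_continuous_onI continuous_intros)
    obtain w where w0: "\<And>X i. i \<notin> A' \<Longrightarrow> w X $ i = 0"
      and wX: "AE X in sample_space n P. \<forall>s<n. w X \<bullet> X s = - (X s $ j)"
      using AE_interpolation[OF assms(1-3) A'(2), of "\<lambda>_ x. - (x $ j)", OF m] by blast
    from wX show ?thesis
    proof eventually_elim
      case (elim X)
      then have "\<forall>s<n. (axis j 1 + w X) \<bullet> X s = 0"
        by (simp add: inner_add_left inner_axis')
      moreover have "(axis j 1 + w X) $ i = 0" if "i \<notin> A" for i
        using that A' w0[of i X] assms(4) \<open>j \<in> C\<close> by (auto simp: axis_def)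
      moreover have "(axis j 1 + w X) $ j \<noteq> 0"
        using \<open>j \<notin> A'\<close> w0[of j X] by (simp add: axis_def)
      ultimately show ?case by blast
    qed
  qed
  then have "AE X in sample_space n P. \<forall>j\<in>C. \<exists>v. (\<forall>i. i \<notin> A \<longrightarrow> v $ i = 0) \<and>
      (\<forall>s<n. v \<bullet> X s = 0) \<and> v $ j \<noteq> 0"
    by (intro AE_finite_allI) auto
  then show ?thesis
  proof eventually_elim
    case (elim X)
    let ?V = "{v. (\<forall>i. i \<notin> A \<longrightarrow> v $ i = 0) \<and> (\<forall>s<n. v \<bullet> X s = 0)}"
    have "\<exists>v\<in>?V. \<forall>i\<in>C. v $ i \<noteq> 0"
      using elim by (intro subspace_common_nonzero) (auto simp: subspace_def inner_add_left)
    then show ?case by blast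
  qed
qed

section \<open>Quadratic forms, traces and determinants\<close>

definition psd :: "real^'n^'n \<Rightarrow> bool" where
  "psd Q \<longleftrightarrow> transpose Q = Q \<and> (\<forall>x. 0 \<le> x \<bullet> (Q *v x))"

lemma inner_matrix_transpose: "x \<bullet> (A *v y) = (transpose A *v x) \<bullet> y" for A :: "real^'n^'m"
  by (metis dot_lmul_matrix inner_commute transpose_matrix_vector)

lemma psd_sandwich:
  assumes "psd Q"
  shows "psd (A ** Q ** transpose A)"
    and "x \<bullet> ((A ** Q ** transpose A) *v x) = (transpose A *v x) \<bullet> (Q *v (transpose A *v x))"
proof -
  show *: "x \<bullet> ((A ** Q ** transpose A) *v x) = (transpose A *v x) \<bullet> (Q *v (transpose A *v x))" for x
    by (simp add: inner_matrix_transpose[of x A] flip: matrix_vector_mul_assoc)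
  show "psd (A ** Q ** transpose A)"
    using assms by (simp add: psd_def * matrix_transpose_mul matrix_mul_assoc)
qed

text \<open>By the parallelogram law the two sides differ by the value of the form at
  \<open>x - y\<close>.\<close>

lemma psd_quadratic_add_le:
  assumes "psd Q"
  shows "(x + y) \<bullet> (Q *v (x + y)) \<le> 2 * (x \<bullet> (Q *v x)) + 2 * (y \<bullet> (Q *v y))"
proof -
  have "0 \<le> (x - y) \<bullet> (Q *v (x - y))"
    using assms by (simp add: psd_def)
  then show ?thesis
    by (simp add: matrix_vector_mult_diff_distrib matrix_vector_right_distrib inner_add_left
        inner_add_right inner_diff_left inner_diff_right)
qed

text \<open>The point is that the constant does not depend on $Q$.\<close>

lemma psd_quadratic_span_bound:
  assumes "y \<in> span (g ` I)" "finite I"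
  shows "\<exists>\<kappa>\<ge>0. \<forall>Q. psd Q \<longrightarrow> y \<bullet> (Q *v y) \<le> \<kappa> * (\<Sum>s\<in>I. g s \<bullet> (Q *v g s))"
  using assms(1)
proof (induction rule: span_induct_alt)
  case base
  show ?case by (intro exI[of _ 0]) simp
next
  case (step c x y)
  obtain \<kappa> where \<kappa>: "\<kappa> \<ge> 0"
    "\<And>Q. psd Q \<Longrightarrow> y \<bullet> (Q *v y) \<le> \<kappa> * (\<Sum>s\<in>I. g s \<bullet> (Q *v g s))"
    using step.IH by blast
  have "(c *\<^sub>R x + y) \<bullet> (Q *v (c *\<^sub>R x + y)) \<le> (2 * c\<^sup>2 + 2 * \<kappa>) * (\<Sum>s\<in>I. g s \<bullet> (Q *v g s))"
    if Q: "psd Q" for Q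
  proof -
    have "x \<bullet> (Q *v x) \<le> (\<Sum>s\<in>I. g s \<bullet> (Q *v g s))"
      using step.hyps(1) assms(2) Q by (auto simp: psd_def intro!: member_le_sum)
    then have "c\<^sup>2 * (x \<bullet> (Q *v x)) \<le> c\<^sup>2 * (\<Sum>s\<in>I. g s \<bullet> (Q *v g s))"
      by (rule mult_left_mono) simp
    moreover have "(c *\<^sub>R x) \<bullet> (Q *v (c *\<^sub>R x)) = c\<^sup>2 * (x \<bullet> (Q *v x))"
      by (simp add: matrix_vector_mult_scaleR power2_eq_square)
    ultimately show ?thesis
      using psd_quadratic_add_le[OF Q, of "c *\<^sub>R x" y] \<kappa>(2)[OF Q]
      by (simp add: distrib_right)
  qed
  then show ?case
    using \<kappa>(1) by (intro exI[of _ "2 * c\<^sup>2 + 2 * \<kappa>"]) auto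
qed

lemma inner_axis_matrix: "axis i 1 \<bullet> (Q *v axis j 1) = Q $ i $ j" for Q :: "real^'n^'n"
  by (simp add: inner_axis' matrix_vector_mul_component inner_axis)

text \<open>Nonnegativity of the form at the sum and the difference of two basis vectors bounds an
  entry by the mean of two diagonal entries. Together with the next lemma this controls the
  determinant by the trace.\<close>

lemma psd_entry_le_trace:
  assumes "psd Q"
  shows "\<bar>Q $ i $ j\<bar> \<le> trace Q"
proof -
  have Q0: "0 \<le> Q $ k $ k" for k
    using assms inner_axis_matrix[of k Q k] by (metis psd_def)
  have "transpose Q $ i $ j = Q $ i $ j"
    using assms by (simp add: psd_def)
  then have sym: "Q $ j $ i = Q $ i $ j"
    by (simp add: transpose_def)
  have "0 \<le> (axis i 1 + axis j 1) \<bullet> (Q *v (axis i 1 + axis j 1))"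
    "0 \<le> (axis i 1 - axis j 1) \<bullet> (Q *v (axis i 1 - axis j 1))"
    using assms by (simp_all add: psd_def)
  then have "2 * \<bar>Q $ i $ j\<bar> \<le> Q $ i $ i + Q $ j $ j"
    by (simp add: matrix_vector_mult_diff_distrib matrix_vector_right_distrib inner_add_left
        inner_add_right inner_diff_left inner_diff_right inner_axis_matrix sym)
  moreover have "Q $ k $ k \<le> trace Q" for k
    unfolding trace_def using Q0 by (intro member_le_sum) auto
  from this[of i] this[of j] have "Q $ i $ i + Q $ j $ j \<le> 2 * trace Q" by simp
  ultimately show ?thesis by simp
qed

text \<open>A termwise estimate of the Leibniz formula. The constant is immaterial, because only the
  logarithm of the bound is used later.\<close>

lemma abs_det_le:
  fixes Q :: "real^'n^'n"
  assumes "\<And>i j. \<bar>Q $ i $ j\<bar> \<le> t"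
  shows "\<bar>det Q\<bar> \<le> fact CARD('n) * t ^ CARD('n)"
proof -
  let ?S = "{p. p permutes (UNIV :: 'n set)}"
  have "\<bar>det Q\<bar> \<le> (\<Sum>p\<in>?S. \<bar>of_int (sign p) * (\<Prod>i\<in>UNIV. Q $ i $ p i)\<bar>)"
    unfolding det_def by (rule sum_abs)
  also have "\<dots> \<le> (\<Sum>p\<in>?S. t ^ CARD('n))"
  proof (rule sum_mono)
    fix p :: "'n \<Rightarrow> 'n"
    have "(\<Prod>i\<in>UNIV. \<bar>Q $ i $ p i\<bar>) \<le> (\<Prod>i\<in>(UNIV::'n set). t)"
      using assms by (intro prod_mono) auto
    then show "\<bar>of_int (sign p) * (\<Prod>i\<in>UNIV. Q $ i $ p i)\<bar> \<le> t ^ CARD('n)"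
      by (simp add: abs_mult abs_prod sign_def)
  qed
  also have "\<dots> = fact CARD('n) * t ^ CARD('n)"
    by (simp add: card_permutations)
  finally show ?thesis .
qed

lemma pos_def_imp_psd: "pos_def W \<Longrightarrow> psd W"
  by (metis inner_zero_left less_eq_real_def pos_def_def psd_def)

lemma pos_def_invertible:
  assumes "pos_def W"
  shows "invertible W"
proof -
  have "x = 0" if "W *v x = 0" for x
    using assms that by (force simp: pos_def_def)
  then show ?thesis
    by (simp add: invertible_left_inverse matrix_left_invertible_ker)
qed

lemma matrix_mul_matrix_inv:
  assumes "invertible A"
  shows "A ** matrix_inv A = mat 1" "matrix_inv A ** A = mat 1"
  using someI_ex[OF assms[unfolded invertible_def]] by (simp_all add: matrix_inv_def)

lemma matrix_inv_unique_right:
  fixes A B :: "real^'n^'n"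
  assumes "A ** B = mat 1"
  shows "matrix_inv A = B"
proof -
  have "invertible A"
    using assms invertible_right_inverse by blast
  then have "matrix_inv A ** (A ** B) = B"
    by (simp add: matrix_mul_assoc matrix_mul_matrix_inv)
  then show ?thesis
    by (simp add: assms)
qed

text \<open>Once the inverse \<open>M\<close> is known to be symmetric, it equals
  \<open>M ** W ** transpose M\<close> and inherits semidefiniteness from \<open>W\<close>.\<close>

lemma psd_matrix_inv:
  assumes "pos_def W"
  shows "psd (matrix_inv W)"
proof -
  let ?M = "matrix_inv W"
  have inv: "W ** ?M = mat 1" "?M ** W = mat 1"
    using pos_def_invertible[OF assms] by (simp_all add: matrix_mul_matrix_inv)
  have W: "transpose W = W" using assms by (simp add: pos_def_def)
  have "W ** transpose ?M = mat 1"
    by (metis W inv(2) matrix_transpose_mul transpose_mat)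
  then have t: "transpose ?M = ?M"
    using matrix_inv_unique_right by metis
  have "?M = ?M ** W ** transpose ?M"
    by (simp add: inv t)
  then show ?thesis
    using psd_sandwich(1)[OF pos_def_imp_psd[OF assms], of ?M] by simp
qed

lemma det_pos_if_pos_def:
  fixes W :: "real^'n^'n"
  assumes "pos_def W"
  shows "det W > 0"
proof (rule ccontr)
  assume "\<not> det W > 0"
  \<comment> \<open>The segment from $W$ to the identity stays positive definite.\<close>
  define F where "F t = t *\<^sub>R mat 1 + (1 - t) *\<^sub>R W" for t :: real
  have "continuous_on {0..1} (\<lambda>t. det (F t))"
    unfolding det_def F_def by (intro continuous_intros)
  then have "\<exists>t. 0 \<le> t \<and> t \<le> 1 \<and> det (F t) = 0"
    using \<open>\<not> det W > 0\<close> by (intro IVT') (auto simp: F_def)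
  then obtain t where t: "0 \<le> t" "t \<le> 1" "det (F t) = 0" by blast
  have "pos_def (F t)"
    unfolding pos_def_def
  proof (intro conjI allI impI)
    show "transpose (F t) = F t"
      using assms by (simp add: F_def pos_def_def transpose_def vec_eq_iff mat_def)
    fix x :: "real^'n" assume "x \<noteq> 0"
    then have 1: "x \<bullet> x > 0" "x \<bullet> (W *v x) > 0" using assms by (auto simp: pos_def_def)
    have "x \<bullet> (F t *v x) = t * (x \<bullet> x) + (1 - t) * (x \<bullet> (W *v x))"
      by (simp add: F_def matrix_vector_mult_add_rdistrib scaleR_matrix_vector_assoc[symmetric] inner_add_right)
    also have "\<dots> > 0"
      using 1 t by (cases "t = 0") (auto intro!: add_pos_nonneg)
    finally show "x \<bullet> (F t *v x) > 0" .
  qed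
  then show False
    using pos_def_invertible invertible_det_nz t(3) by blast
qed

section \<open>Block structure along the bidirected components\<close>

lemma sym_rtrancl_bidi_rel: "sym ((bidi_rel B)\<^sup>*)"
  by (rule sym_rtrancl) (auto simp: sym_def bidi_rel_def insert_commute)

lemma bidi_component_eq:
  assumes "C \<in> bidi_components B" "i \<in> C"
  shows "C = {j. (i, j) \<in> (bidi_rel B)\<^sup>*}"
proof -
  obtain k where k: "C = {j. (k, j) \<in> (bidi_rel B)\<^sup>*}"
    using assms(1) by (auto simp: bidi_components_def)
  then have "(k, i) \<in> (bidi_rel B)\<^sup>*" "(i, k) \<in> (bidi_rel B)\<^sup>*"
    using assms(2) sym_rtrancl_bidi_rel[of B] by (auto dest: symD)
  then show ?thesis
    unfolding k by (auto intro: rtrancl_trans)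
qed

text \<open>The components partition the vertices, so exactly one summand survives.\<close>

lemma sum_bidi_components:
  fixes i :: "'n::finite" and c :: real
  shows "(\<Sum>C\<in>bidi_components B. if i \<in> C then c else 0) = c"
proof -
  let ?C = "{j. (i, j) \<in> (bidi_rel B)\<^sup>*}"
  have "?C \<in> bidi_components B"
    by (auto simp: bidi_components_def)
  moreover have "i \<in> C \<longleftrightarrow> C = ?C" if "C \<in> bidi_components B" for C
    using bidi_component_eq[OF that, of i] by auto
  ultimately show ?thesis
    by (simp add: sum.delta cong: sum.cong)
qed

lemma PD_B_off_component:
  assumes "W \<in> PD_B B" "C \<in> bidi_components B" "i \<in> C \<longleftrightarrow> j \<notin> C"
  shows "W $ i $ j = 0"
proof (rule ccontr)
  assume "W $ i $ j \<noteq> 0"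
  moreover have "i \<noteq> j" using assms(3) by auto
  ultimately have "{i, j} \<in> B" using assms(1) by (auto simp: PD_B_def)
  then have "(i, j) \<in> (bidi_rel B)\<^sup>*" "(j, i) \<in> (bidi_rel B)\<^sup>*"
    by (auto simp: bidi_rel_def insert_commute)
  then show False
    using assms(3) bidi_component_eq[OF assms(2), of i] bidi_component_eq[OF assms(2), of j] by blast
qed

lemma coord_proj_PD_B_mult:
  assumes "W \<in> PD_B B" "C \<in> bidi_components B"
  shows "coord_proj C (W *v x) = W *v coord_proj C x"
  using PD_B_off_component[OF assms]
  by (auto simp: vec_eq_iff coord_proj_def matrix_vector_mult_def intro!: sum.cong sum.neutral)

text \<open>Block diagonality is expressed as commuting with the projections onto components, a
  property that passes from a matrix to its inverse.\<close>

lemma coord_proj_inv_PD_B_mult: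
  assumes "W \<in> PD_B B" "C \<in> bidi_components B"
  shows "coord_proj C (matrix_inv W *v x) = matrix_inv W *v coord_proj C x"
proof -
  have inv: "W ** matrix_inv W = mat 1" "matrix_inv W ** W = mat 1"
    using assms(1) by (auto simp: PD_B_def pos_def_invertible matrix_mul_matrix_inv)
  have "coord_proj C (matrix_inv W *v x) = matrix_inv W *v (W *v coord_proj C (matrix_inv W *v x))"
    by (simp add: matrix_vector_mul_assoc inv)
  also have "W *v coord_proj C (matrix_inv W *v x) = coord_proj C x"
    by (simp add: matrix_vector_mul_assoc inv flip: coord_proj_PD_B_mult[OF assms])
  finally show ?thesis .
qed

lemma sum_coord_proj_components:
  "(\<Sum>C\<in>bidi_components B. coord_proj C x) = x"
  by (simp add: vec_eq_iff coord_proj_def sum_bidi_components)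

text \<open>Mixed terms vanish because the inverse maps each block to itself and different blocks
  are orthogonal.\<close>

lemma inv_PD_B_quadratic_split:
  assumes "W \<in> PD_B B"
  shows "y \<bullet> (matrix_inv W *v y) =
    (\<Sum>C\<in>bidi_components B. coord_proj C y \<bullet> (matrix_inv W *v coord_proj C y))"
proof -
  have "coord_proj C y \<bullet> z = coord_proj C y \<bullet> coord_proj C z" for C z
    by (simp add: inner_coord_proj coord_proj_def[of C y])
  then have "(\<Sum>C\<in>bidi_components B. coord_proj C y) \<bullet> (matrix_inv W *v y) =
    (\<Sum>C\<in>bidi_components B. coord_proj C y \<bullet> coord_proj C (matrix_inv W *v y))"
    unfolding inner_sum_left by (intro sum.cong refl)
  then show ?thesis
    using assms by (simp add: sum_coord_proj_components coord_proj_inv_PD_B_mult)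
qed

text \<open>A column of \<open>mat 1 - L\<close> indexed by a node of \<open>C\<close> is supported
  on that node and its parents. This is why the form of a component sees only
  \<open>Pa D C\<close>.\<close>

lemma coord_proj_regression:
  assumes "L \<in> RD_reg D"
  shows "coord_proj C (transpose (mat 1 - L) *v x) =
    coord_proj C (transpose (mat 1 - L) *v coord_proj (Pa D C) x)"
proof -
  have "(mat 1 - L) $ k $ i = 0" if "i \<in> C" "k \<notin> Pa D C" for i k
    using assms that by (auto simp: RD_reg_def Pa_def pa_def mat_def)
  then show ?thesis
    by (auto simp: vec_eq_iff coord_proj_def matrix_vector_mult_def transpose_def intro!: sum.cong)
qed

section \<open>Inverse and determinant of a covariance matrix in the model\<close>

lemma PD_G_inverse_det:
  assumes L: "L \<in> RD_reg D" and W: "W \<in> PD_B B"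
    and Sig: "Sig = transpose (matrix_inv (mat 1 - L)) ** W ** matrix_inv (mat 1 - L)"
  shows "matrix_inv Sig = (mat 1 - L) ** matrix_inv W ** transpose (mat 1 - L)"
    and "det Sig * (det (mat 1 - L))\<^sup>2 = det W"
proof -
  define A where "A = mat 1 - L"
  define N where "N = matrix_inv A"
  have A: "A ** N = mat 1" "N ** A = mat 1"
    using L by (auto simp: A_def N_def RD_reg_def matrix_mul_matrix_inv)
  have A_t: "transpose A ** transpose N = mat 1" "transpose N ** transpose A = mat 1"
    by (simp_all add: A flip: matrix_transpose_mul)
  have inv: "W ** matrix_inv W = mat 1"
    using W by (auto simp: PD_B_def pos_def_invertible matrix_mul_matrix_inv)
  have "Sig ** (A ** matrix_inv W ** transpose A) =
      transpose N ** (W ** ((N ** A) ** matrix_inv W)) ** transpose A"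
    unfolding Sig A_def[symmetric] N_def[symmetric] by (simp only: matrix_mul_assoc)
  also have "\<dots> = mat 1"
    by (simp add: A A_t inv)
  finally show "matrix_inv Sig = (mat 1 - L) ** matrix_inv W ** transpose (mat 1 - L)"
    unfolding A_def by (rule matrix_inv_unique_right)
  have "det N * det A = 1"
    by (metis A(2) det_I det_mul)
  moreover have "det Sig = det N * det W * det N"
    unfolding Sig A_def[symmetric] N_def[symmetric] by (simp add: det_mul)
  ultimately have "det Sig * (det A)\<^sup>2 = det W"
    by (simp add: power2_eq_square) (metis (no_types, lifting) mult.assoc mult.commute mult.left_neutral)
  then show "det Sig * (det (mat 1 - L))\<^sup>2 = det W"
    by (simp add: A_def)
qed

lemma PD_G_cases:
  assumes "Sig \<in> PD_G D B"
  obtains L W where "L \<in> RD_reg D" "W \<in> PD_B B"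
    "matrix_inv Sig = (mat 1 - L) ** matrix_inv W ** transpose (mat 1 - L)"
    "det Sig * (det (mat 1 - L))\<^sup>2 = det W"
proof -
  obtain L W where LW: "L \<in> RD_reg D" "W \<in> PD_B B"
    "Sig = transpose (matrix_inv (mat 1 - L)) ** W ** matrix_inv (mat 1 - L)"
    using assms by (auto simp: PD_G_def)
  show thesis
    by (rule that[OF LW(1,2) PD_G_inverse_det[OF LW]])
qed

section \<open>Boundedness of the likelihood for spanning samples\<close>

lemma trace_mult_S0:
  "trace (K ** S0 n X) = (\<Sum>s<n. X s \<bullet> (K *v X s)) / real n"
proof -
  \<comment> \<open>For \<open>n = 0\<close> both sides are 0 by the convention for division by
    zero, so the empty sample is covered as well.\<close>
  have "trace (K ** S0 n X) = (\<Sum>i\<in>UNIV. \<Sum>j\<in>UNIV. \<Sum>s<n. K $ i $ j * (X s $ j * X s $ i) / real n)"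
    by (simp add: trace_def matrix_matrix_mult_def S0_def sum_distrib_left sum_divide_distrib)
  also have "\<dots> = (\<Sum>s<n. \<Sum>i\<in>UNIV. \<Sum>j\<in>UNIV. K $ i $ j * (X s $ j * X s $ i) / real n)"
    by (subst sum.swap[of _ UNIV "{..<n}", symmetric], subst sum.swap[of _ UNIV "{..<n}", symmetric]) (rule refl)
  also have "\<dots> = (\<Sum>s<n. X s \<bullet> (K *v X s)) / real n"
    by (simp add: inner_vec_def matrix_vector_mult_def sum_distrib_left sum_divide_distrib mult_ac)
  finally show ?thesis .
qed

text \<open>The trace is the sum of all component forms at all basis vectors. Each such form sees
  only the projections to \<open>Pa D C\<close>, where the basis vectors are combinations of the
  sample points, with a constant chosen before the matrix \<open>Sig\<close>.\<close>

lemma PD_G_trace_bound: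
  fixes D :: "('n::finite \<times> 'n) set" and X :: "nat \<Rightarrow> real^'n"
  assumes "\<And>C i. C \<in> bidi_components B \<Longrightarrow>
      coord_proj (Pa D C) (axis i 1) \<in> span ((\<lambda>s. coord_proj (Pa D C) (X s)) ` {..<n})"
  shows "\<exists>\<kappa>\<ge>0. \<forall>Sig\<in>PD_G D B. trace (matrix_inv Sig) \<le> \<kappa> * (\<Sum>s<n. X s \<bullet> (matrix_inv Sig *v X s))"
proof -
  let ?e = "\<lambda>C i. coord_proj (Pa D C) (axis i 1) :: real^'n"
  let ?g = "\<lambda>C s. coord_proj (Pa D C) (X s)"
  have "\<forall>C i. \<exists>\<kappa>. C \<in> bidi_components B \<longrightarrow> \<kappa> \<ge> 0 \<and>
      (\<forall>Q. psd Q \<longrightarrow> ?e C i \<bullet> (Q *v ?e C i) \<le> \<kappa> * (\<Sum>s<n. ?g C s \<bullet> (Q *v ?g C s)))"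
    using psd_quadratic_span_bound[OF assms finite_lessThan] by blast
  then have "\<exists>k. \<forall>C i. C \<in> bidi_components B \<longrightarrow> k C i \<ge> 0 \<and>
      (\<forall>Q. psd Q \<longrightarrow> ?e C i \<bullet> (Q *v ?e C i) \<le> k C i * (\<Sum>s<n. ?g C s \<bullet> (Q *v ?g C s)))"
    by (simp only: choice_iff)
  then obtain k where k': "\<forall>C i. C \<in> bidi_components B \<longrightarrow> k C i \<ge> 0 \<and>
      (\<forall>Q. psd Q \<longrightarrow> ?e C i \<bullet> (Q *v ?e C i) \<le> k C i * (\<Sum>s<n. ?g C s \<bullet> (Q *v ?g C s)))"
    by (rule exE)
  have k: "k C i \<ge> 0" if "C \<in> bidi_components B" for C i
    using k' that by simp
  have k_bound: "?e C i \<bullet> (Q *v ?e C i) \<le> k C i * (\<Sum>s<n. ?g C s \<bullet> (Q *v ?g C s))"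
    if "C \<in> bidi_components B" "psd Q" for C i Q
    using k' that by simp
  \<comment> \<open>The sum serves as a common upper bound for finitely many nonnegative
    constants.\<close>
  define \<kappa> where "\<kappa> = (\<Sum>C\<in>bidi_components B. \<Sum>i\<in>UNIV. k C i)"
  have \<kappa>: "\<kappa> \<ge> 0"
    unfolding \<kappa>_def using k by (intro sum_nonneg) auto
  have k_le: "k C i \<le> \<kappa>" if "C \<in> bidi_components B" for C i
  proof -
    have "k C i \<le> (\<Sum>i\<in>UNIV. k C i)"
      using k that by (intro member_le_sum) auto
    also have "\<dots> \<le> \<kappa>"
      unfolding \<kappa>_def using k that by (intro member_le_sum sum_nonneg) auto
    finally show ?thesis .
  qed
  have "trace (matrix_inv Sig) \<le> CARD('n) * \<kappa> * (\<Sum>s<n. X s \<bullet> (matrix_inv Sig *v X s))"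
    if "Sig \<in> PD_G D B" for Sig
  proof -
    obtain L W where L: "L \<in> RD_reg D" and W: "W \<in> PD_B B"
      and K: "matrix_inv Sig = (mat 1 - L) ** matrix_inv W ** transpose (mat 1 - L)"
      by (rule PD_G_cases[OF \<open>Sig \<in> PD_G D B\<close>]) (rule that, assumption+)
    define A where "A = mat 1 - L"
    define M where "M = matrix_inv W"
    have M: "psd M"
      unfolding M_def using W by (auto simp: PD_B_def intro: psd_matrix_inv)
    define q where "q C x = coord_proj C (transpose A *v x) \<bullet> (M *v coord_proj C (transpose A *v x))" for C x
    have split: "x \<bullet> (matrix_inv Sig *v x) = (\<Sum>C\<in>bidi_components B. q C x)" for x
      unfolding K A_def[symmetric] M_def[symmetric] psd_sandwich(2)[OF M] q_def
      unfolding M_def by (rule inv_PD_B_quadratic_split[OF W])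
    have local: "q C x = q C (coord_proj (Pa D C) x)" for C x
      unfolding q_def A_def by (simp only: coord_proj_regression[OF L, of C x, symmetric])
    \<comment> \<open>The bound \<open>k_bound\<close> speaks about matrices, so \<open>q C\<close>
      is represented by one: the projection becomes the diagonal 0-1 matrix \<open>J\<close>, and
      \<open>M\<close> is sandwiched by \<open>A ** J\<close>.\<close>
    have q_form: "\<exists>Q. psd Q \<and> (\<forall>x. x \<bullet> (Q *v x) = q C x)" for C
    proof -
      define J where "J = (\<chi> i j. if i = j then if i \<in> C then 1 else 0 else (0 :: real))"
      have "transpose (A ** J) *v x = coord_proj C (transpose A *v x)" for x
      proof -
        have "transpose J *v y = coord_proj C y" for y
          by (auto simp: vec_eq_iff J_def transpose_def matrix_vector_mult_def coord_proj_def
              if_distrib[of "\<lambda>c. c * _"] cong: if_cong)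
        then show ?thesis
          by (simp add: matrix_transpose_mul flip: matrix_vector_mul_assoc)
      qed
      then show ?thesis
        using psd_sandwich[OF M, where A="A ** J"] by (intro exI[of _ "A ** J ** M ** transpose (A ** J)"]) (simp add: q_def)
    qed
    have q_nonneg: "q C x \<ge> 0" for C x
      using q_form[of C] by (metis psd_def)
    have q_bound: "q C (axis i 1) \<le> \<kappa> * (\<Sum>s<n. q C (X s))" if C: "C \<in> bidi_components B" for C i
    proof -
      obtain Q where Q: "psd Q" "\<And>x. x \<bullet> (Q *v x) = q C x" using q_form[of C] by blast
      have "q C (axis i 1) \<le> k C i * (\<Sum>s<n. q C (X s))"
        using k_bound[OF C Q(1), of i] by (simp add: Q(2) flip: local)
      also have "\<dots> \<le> \<kappa> * (\<Sum>s<n. q C (X s))"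
        using k_le[OF C] q_nonneg by (intro mult_right_mono sum_nonneg) auto
      finally show ?thesis .
    qed
    have "trace (matrix_inv Sig) = (\<Sum>i\<in>UNIV. \<Sum>C\<in>bidi_components B. q C (axis i 1))"
      by (simp add: trace_def flip: split inner_axis_matrix)
    \<comment> \<open>The bound no longer depends on \<open>i\<close>; summing it over all vertices
      produces the factor \<open>CARD('n)\<close>.\<close>
    also have "\<dots> \<le> (\<Sum>i\<in>(UNIV::'n set). \<Sum>C\<in>bidi_components B. \<kappa> * (\<Sum>s<n. q C (X s)))"
      using q_bound by (intro sum_mono) auto
    also have "\<dots> = CARD('n) * \<kappa> * (\<Sum>s<n. \<Sum>C\<in>bidi_components B. q C (X s))"
      by (subst sum.swap[of _ _ "{..<n}"]) (simp add: mult.assoc flip: sum_distrib_left)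
    finally show ?thesis
      by (simp add: split)
  qed
  then show ?thesis
    using \<kappa> by (intro exI[of _ "CARD('n) * \<kappa>"]) auto
qed

lemma PD_G_det_pos:
  assumes "Sig \<in> PD_G D B"
  shows "det Sig > 0"
proof -
  obtain L W where "L \<in> RD_reg D" "W \<in> PD_B B" and d: "det Sig * (det (mat 1 - L))\<^sup>2 = det W"
    by (rule PD_G_cases[OF assms]) (rule that, assumption+)
  then have "det Sig * (det (mat 1 - L))\<^sup>2 > 0"
    by (auto simp: PD_B_def det_pos_if_pos_def)
  then show ?thesis
    by (simp add: zero_less_mult_iff) 
qed

text \<open>With \<open>t\<close> the trace of the inverse of \<open>Sig\<close>, the determinant
  term contributes at most a constant plus \<open>p * ln t\<close>, while the trace term subtracts
  at least \<open>t / c\<close>. The linear term wins.\<close>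

lemma lhat_less_infinity:
  fixes D :: "('n::finite \<times> 'n) set" and X :: "nat \<Rightarrow> real^'n"
  assumes "n > 0" and "\<And>C i. C \<in> bidi_components B \<Longrightarrow>
      coord_proj (Pa D C) (axis i 1) \<in> span ((\<lambda>s. coord_proj (Pa D C) (X s)) ` {..<n})"
  shows "lhat D B (S0 n X) < \<infinity>"
proof -
  obtain \<kappa> where "\<kappa> \<ge> 0" and tr_bound: "\<And>Sig. Sig \<in> PD_G D B \<Longrightarrow>
      trace (matrix_inv Sig) \<le> \<kappa> * (\<Sum>s<n. X s \<bullet> (matrix_inv Sig *v X s))"
    using PD_G_trace_bound[OF assms(2)] by blast
  define p where "p = real CARD('n)"
  \<comment> \<open>The summand 1 keeps \<open>c\<close> positive even if
    \<open>\<kappa> = 0\<close>.\<close>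
  define c where "c = \<kappa> * n + 1"
  have pos: "p > 0" "c > 0"
    using \<open>\<kappa> \<ge> 0\<close> by (auto simp: p_def c_def intro: add_nonneg_pos)
  have "loglik Sig (S0 n X) \<le> ln (fact CARD('n)) + p * ln (c * p) - p" if Sig: "Sig \<in> PD_G D B" for Sig
  proof -
    define K where "K = matrix_inv Sig"
    define t where "t = trace K"
    define T where "T = trace (K ** S0 n X)"
    obtain L W where "W \<in> PD_B B"
      and "matrix_inv Sig = (mat 1 - L) ** matrix_inv W ** transpose (mat 1 - L)"
      by (rule PD_G_cases[OF Sig]) (rule that, assumption+)
    then have K: "psd K"
      by (auto simp: K_def PD_B_def intro!: psd_sandwich(1) psd_matrix_inv)
    have "Sig ** K = mat 1"
      unfolding K_def using PD_G_det_pos[OF Sig] by (intro matrix_mul_matrix_inv) (simp add: invertible_det_nz)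
    then have det_K: "det Sig * det K = 1"
      by (metis det_I det_mul)
    then have "det K = inverse (det Sig)"
      by (rule inverse_unique[symmetric])
    then have "det K > 0" and ln_det: "- ln (det Sig) = ln (det K)"
      using PD_G_det_pos[OF Sig] by (simp_all add: ln_inverse)
    have det_le: "det K \<le> fact CARD('n) * t ^ CARD('n)"
      using abs_det_le[of K t] psd_entry_le_trace[OF K] by (simp add: t_def)
    have "t \<ge> 0"
      using psd_entry_le_trace[OF K, of undefined undefined] by (simp add: t_def)
    \<comment> \<open>If \<open>t\<close> were 0, the determinant bound would be 0 too, since the
      dimension is positive.\<close>
    moreover have "t \<noteq> 0"
      using det_le \<open>det K > 0\<close> by (auto simp: zero_power)
    ultimately have "t > 0" by simp
    have T: "T = (\<Sum>s<n. X s \<bullet> (K *v X s)) / n"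
      unfolding T_def by (rule trace_mult_S0)
    have "T \<ge> 0"
      unfolding T using K by (auto simp: psd_def intro!: divide_nonneg_nonneg sum_nonneg)
    have "t \<le> \<kappa> * n * T"
      using tr_bound[OF Sig] \<open>n > 0\<close> by (simp add: T t_def K_def)
    also have "\<dots> \<le> c * T"
      unfolding c_def using \<open>T \<ge> 0\<close> by (intro mult_right_mono) auto
    finally have "t / c \<le> T"
      using pos by (simp add: field_simps)
    have "ln (det K) \<le> ln (fact CARD('n) * t ^ CARD('n))"
      using det_le \<open>det K > 0\<close> by (intro ln_mono) auto
    also have "\<dots> = ln (fact CARD('n)) + p * ln t"
      using \<open>t > 0\<close> by (simp add: ln_mult ln_realpow p_def)
    finally have 1: "ln (det K) \<le> ln (fact CARD('n)) + p * ln t" .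
    \<comment> \<open>The tangent inequality for the logarithm, scaled so that after multiplication
      by \<open>p\<close> the linear term is exactly \<open>t / c\<close> and is absorbed by
      \<open>T\<close>.\<close>
    have "ln (t / (c * p)) \<le> t / (c * p) - 1"
      using \<open>t > 0\<close> pos by (intro ln_le_minus_one) auto
    then have "p * ln t \<le> p * (ln (c * p) + t / (c * p) - 1)"
      using \<open>t > 0\<close> pos by (intro mult_left_mono) (auto simp: ln_div)
    also have "\<dots> = p * ln (c * p) + t / c - p"
      using pos by (simp add: field_simps)
    finally show ?thesis
      using 1 \<open>t / c \<le> T\<close> by (simp add: loglik_def ln_det flip: K_def T_def)
  qed
  then have "lhat D B (S0 n X) \<le> ereal (ln (fact CARD('n)) + p * ln (c * p) - p)"
    unfolding lhat_def by (intro SUP_least) simp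
  then show ?thesis
    by (rule order.strict_trans1) simp
qed

section \<open>Unboundedness of the likelihood for small samples\<close>

text \<open>Each \<open>i\<close> in \<open>Pa D C - C\<close> uses a single edge to a chosen child
  \<open>f i\<close> in \<open>C\<close>. The weight divides by the nonzero coordinate of
  \<open>v\<close> at that child, so the edge reproduces \<open>v $ i\<close>, and the rows in
  \<open>C\<close> stay zero. Orthogonality of \<open>v\<close> to the sample thereby becomes
  orthogonality of its part on \<open>C\<close> to the transformed sample.\<close>

lemma RD_reg_map_coord_proj:
  fixes D :: "('n::finite \<times> 'n) set" and v :: "real^'n"
  assumes v0: "\<And>i. i \<notin> Pa D C \<Longrightarrow> v $ i = 0" and nz: "\<And>i. i \<in> C \<Longrightarrow> v $ i \<noteq> 0"
  shows "\<exists>L\<in>RD_reg D. (mat 1 - L) *v coord_proj C v = v"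
proof -
  have "\<exists>j. j \<in> C \<and> (i, j) \<in> D" if "i \<in> Pa D C - C" for i
    using that by (auto simp: Pa_def pa_def)
  then obtain f where f: "\<And>i. i \<in> Pa D C - C \<Longrightarrow> f i \<in> C \<and> (i, f i) \<in> D"
    by metis
  \<comment> \<open>All edges used lead from outside $C$ into $C$, so $L$ is nilpotent even if $D$ has cycles.\<close>
  define L :: "real^'n^'n" where
    "L = (\<chi> i j. if j = f i then if i \<in> Pa D C - C then - (v $ i) / v $ j else 0 else 0)"
  have "L ** L = 0"
    using f by (auto simp: vec_eq_iff matrix_matrix_mult_def L_def intro!: sum.neutral)
  then have "L *v (L *v x) = 0" for x
    by (simp add: matrix_vector_mul_assoc)
  then have "(mat 1 - L) ** (mat 1 + L) = mat 1"
    by (simp add: matrix_eq matrix_vector_mult_diff_rdistrib matrix_vector_mult_add_rdistrib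
        matrix_vector_right_distrib flip: matrix_vector_mul_assoc)
  then have "invertible (mat 1 - L)"
    using invertible_right_inverse by blast
  moreover have "L $ i $ j = 0" if "(i, j) \<notin> D" for i j
    using that f by (auto simp: L_def)
  ultimately have "L \<in> RD_reg D"
    by (simp add: RD_reg_def)
  moreover have "(mat 1 - L) *v coord_proj C v = v"
  proof -
    have "(L *v coord_proj C v) $ i = (if i \<in> Pa D C - C then - (v $ i) else 0)" for i
      using f[of i] nz by (auto simp: matrix_vector_mult_def L_def coord_proj_def
          if_distrib[of "\<lambda>c. c * _"] cong: if_cong)
    then show ?thesis
      using v0 by (auto simp: matrix_vector_mult_diff_rdistrib vec_eq_iff coord_proj_def)
  qed
  ultimately show ?thesis by blast
qed

text \<open>The sum of the outer products of the vectors in \<open>F\<close> with themselves. For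
  finite \<open>F\<close> its kernel is the orthogonal complement of \<open>F\<close>, so kernel and
  zero pattern can be designed through the choice of \<open>F\<close>.\<close>

definition gram :: "(real^'n) set \<Rightarrow> real^'n^'n" where
  "gram F = (\<chi> i j. \<Sum>d\<in>F. d $ i * d $ j)"

lemma gram_mult: "gram F *v z = (\<Sum>d\<in>F. (d \<bullet> z) *\<^sub>R d)"
  by (simp add: vec_eq_iff gram_def matrix_vector_mult_def inner_vec_def sum_distrib_right
      sum_distrib_left sum.swap[of _ F] mult_ac)

lemma psd_gram: "psd (gram F)"
proof -
  have "transpose (gram F) = gram F"
    by (simp add: transpose_def gram_def vec_eq_iff mult.commute)
  then show ?thesis
    by (auto simp: psd_def gram_mult inner_sum_right inner_commute intro!: sum_nonneg)
qed

lemma gram_kernel: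
  assumes "finite F"
  shows "gram F *v z = 0 \<longleftrightarrow> (\<forall>d\<in>F. d \<bullet> z = 0)"
proof
  assume "gram F *v z = 0"
  then have "z \<bullet> (gram F *v z) = 0" by simp
  then have "(\<Sum>d\<in>F. (d \<bullet> z)\<^sup>2) = 0"
    by (simp add: gram_mult inner_sum_right inner_commute power2_eq_square)
  then show "\<forall>d\<in>F. d \<bullet> z = 0"
    using assms by (simp add: sum_nonneg_eq_0_iff)
qed (simp add: gram_mult)

text \<open>Orthogonality to the vector of an edge equates the ratios \<open>z $ i / u $ i\<close>
  at its two ends, and connectedness of \<open>C\<close> spreads this equality over all of
  \<open>C\<close>. The zero pattern holds because each vector used is supported on one vertex or on
  the ends of one bidirected edge.\<close>

lemma ex_psd_kernel_span:
  fixes B :: "'n::finite set set" and u :: "real^'n"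
  assumes C: "C \<in> bidi_components B" and u: "\<And>i. u $ i \<noteq> 0 \<longleftrightarrow> i \<in> C"
  shows "\<exists>W. psd W \<and> (\<forall>i j. i \<noteq> j \<and> {i, j} \<notin> B \<longrightarrow> W $ i $ j = 0) \<and>
    (\<forall>z. W *v z = 0 \<longleftrightarrow> z \<in> range (\<lambda>c. c *\<^sub>R u))"
proof -
  define E where "E = {(i, j). i \<in> C \<and> (i, j) \<in> bidi_rel B}"
  \<comment> \<open>A weighted graph Laplacian on $C$, and the identity off $C$.\<close>
  define F where "F = (\<lambda>(i, j). axis i (1 / u $ i) - axis j (1 / u $ j)) ` E \<union> (\<lambda>k. axis k 1) ` (- C)"
  have [simp]: "finite F" by (simp add: F_def)
  have E: "(i, j) \<in> E \<longleftrightarrow> i \<in> C \<and> j \<in> C \<and> {i, j} \<in> B" for i j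
    using bidi_component_eq[OF C, of i] by (auto simp: E_def bidi_rel_def)
  have "gram F $ i $ j = 0" if "i \<noteq> j" "{i, j} \<notin> B" for i j
  proof -
    have "d $ i * d $ j = 0" if "d \<in> F" for d
      using that \<open>i \<noteq> j\<close> \<open>{i, j} \<notin> B\<close> by (auto simp: F_def E axis_def insert_commute split: if_splits)
    then show ?thesis unfolding gram_def by (simp add: sum.neutral)
  qed
  moreover have "gram F *v z = 0 \<longleftrightarrow> z \<in> range (\<lambda>c. c *\<^sub>R u)" for z
  proof -
    have ker: "gram F *v z = 0 \<longleftrightarrow> (\<forall>i j. (i, j) \<in> E \<longrightarrow> z $ i / u $ i = z $ j / u $ j) \<and> (\<forall>k. k \<notin> C \<longrightarrow> z $ k = 0)"
      unfolding gram_kernel[OF \<open>finite F\<close>]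
      by (auto simp: F_def ball_Un split_beta inner_diff_left inner_axis')
    show ?thesis
    proof
      assume "gram F *v z = 0"
      with ker have e: "\<And>i j. (i, j) \<in> E \<Longrightarrow> z $ i / u $ i = z $ j / u $ j" and z0: "\<And>k. k \<notin> C \<Longrightarrow> z $ k = 0"
        by auto
      obtain i where i: "i \<in> C" using C by (auto simp: bidi_components_def)
      have "z $ j / u $ j = z $ i / u $ i" if "(i, j) \<in> (bidi_rel B)\<^sup>*" for j
        using that
      proof (induction rule: rtrancl_induct)
        case (step j k)
        then have "(j, k) \<in> E" using bidi_component_eq[OF C i] by (auto simp: E_def)
        then show ?case using e[of j k] step.IH by simp
      qed simp
      moreover have "(i, j) \<in> (bidi_rel B)\<^sup>*" if "j \<in> C" for j
        using bidi_component_eq[OF C i] that by blast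
      ultimately have ratio: "z $ j / u $ j = z $ i / u $ i" if "j \<in> C" for j
        using that by blast
      have "z $ j = (z $ i / u $ i) * u $ j" for j
      proof (cases "j \<in> C")
        case True
        then show ?thesis
          unfolding ratio[OF True, symmetric] using u[of j] by simp
      next
        case False
        then show ?thesis
          using u[of j] z0[of j] by simp
      qed
      then have "z = (z $ i / u $ i) *\<^sub>R u"
        unfolding vec_eq_iff vector_scaleR_component real_scaleR_def by (intro allI)
      then show "z \<in> range (\<lambda>c. c *\<^sub>R u)" by (rule range_eqI)
    next
      assume "z \<in> range (\<lambda>c. c *\<^sub>R u)"
      then obtain c where z: "z = c *\<^sub>R u" by (rule rangeE)
      have "z $ i / u $ i = c" if "i \<in> C" for i
        using u[of i] that by (simp add: z)
      moreover have "z $ k = 0" if "k \<notin> C" for k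
        using u[of k] that by (simp add: z)
      ultimately show "gram F *v z = 0"
        unfolding ker by (simp add: E)
    qed
  qed
  ultimately show ?thesis
    using psd_gram[of F] by blast
qed

lemma psd_range_orthogonal_kernel:
  assumes W: "psd W" and ker: "\<And>z. W *v z = 0 \<longleftrightarrow> z \<in> range (\<lambda>c. c *\<^sub>R u)"
    and "u \<noteq> 0" "y \<bullet> u = 0"
  shows "\<exists>z. W *v z = y"
proof -
  \<comment> \<open>$W + u u^T$ is invertible; solve for it, and orthogonality to $u$ removes the correction.\<close>
  define G where "G = W + gram {u}"
  have G: "G *v z = W *v z + (u \<bullet> z) *\<^sub>R u" for z
    by (simp add: G_def matrix_vector_mult_add_rdistrib gram_mult)
  have Wu: "W *v u = 0"
    unfolding ker by (metis rangeI scaleR_one)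
  have u_W: "u \<bullet> (W *v z) = 0" for z
    using W Wu by (simp add: inner_matrix_transpose psd_def)
  have "z = 0" if "G *v z = 0" for z
  proof -
    have "u \<bullet> (G *v z) = (u \<bullet> z) * (u \<bullet> u)"
      by (simp add: G inner_add_right u_W)
    then have uz: "u \<bullet> z = 0" using that \<open>u \<noteq> 0\<close> by simp
    then have "W *v z = 0" using that by (simp add: G)
    then show "z = 0" using uz \<open>u \<noteq> 0\<close> by (auto simp: ker)
  qed
  then have "invertible G"
    by (simp add: invertible_left_inverse matrix_left_invertible_ker)
  then have "G *v (matrix_inv G *v y) = y"
    by (simp add: matrix_vector_mul_assoc matrix_mul_matrix_inv)
  then obtain z where z: "G *v z = y" by blast
  have "u \<bullet> (G *v z) = (u \<bullet> z) * (u \<bullet> u)"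
    by (simp add: G inner_add_right u_W)
  then have "u \<bullet> z = 0"
    using assms(3,4) by (simp add: z inner_commute)
  then show ?thesis
    using z by (auto simp: G)
qed

lemma pos_def_psd_add_scaled_mat:
  assumes "psd W" "\<epsilon> > 0"
  shows "pos_def (W + \<epsilon> *\<^sub>R mat 1)"
    and "x \<bullet> ((W + \<epsilon> *\<^sub>R mat 1) *v x) = x \<bullet> (W *v x) + \<epsilon> * (x \<bullet> x)"
proof -
  show *: "x \<bullet> ((W + \<epsilon> *\<^sub>R mat 1) *v x) = x \<bullet> (W *v x) + \<epsilon> * (x \<bullet> x)" for x
    by (simp add: matrix_vector_mult_add_rdistrib scaleR_matrix_vector_assoc[symmetric] inner_add_right)
  have "transpose (W + \<epsilon> *\<^sub>R mat 1) = W + \<epsilon> *\<^sub>R mat 1"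
    using assms(1) by (simp add: psd_def transpose_def vec_eq_iff mat_def) 
  then show "pos_def (W + \<epsilon> *\<^sub>R mat 1)"
    using assms by (auto simp: pos_def_def psd_def * intro!: add_nonneg_pos)
qed

text \<open>On the range of \<open>W\<close> the regularized inverse stays bounded as \<epsilon>
  tends to 0. With \<open>y = W *v z\<close> and \<open>w\<close> the solution of the regularized
  system, \<open>w \<bullet> (W *v w) \<le> w \<bullet> y\<close>; nonnegativity of the form at
  \<open>z - w\<close> then yields the claim.\<close>

lemma regularized_inverse_quadratic_le:
  assumes W: "psd W" and "\<epsilon> > 0"
  shows "(W *v z) \<bullet> (matrix_inv (W + \<epsilon> *\<^sub>R mat 1) *v (W *v z)) \<le> z \<bullet> (W *v z)"
proof -
  let ?G = "W + \<epsilon> *\<^sub>R mat 1"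
  define y where "y = W *v z"
  define w where "w = matrix_inv ?G *v y"
  have "?G *v w = y"
    unfolding w_def using pos_def_psd_add_scaled_mat(1)[OF assms]
    by (simp add: matrix_vector_mul_assoc pos_def_invertible matrix_mul_matrix_inv del: scaleR_matrix_vector_assoc)
  then have "w \<bullet> y = w \<bullet> (W *v w) + \<epsilon> * (w \<bullet> w)"
    using pos_def_psd_add_scaled_mat(2)[OF assms] by metis
  then have "w \<bullet> (W *v w) \<le> w \<bullet> y"
    using \<open>\<epsilon> > 0\<close> by simp
  moreover have "z \<bullet> (W *v w) = w \<bullet> y"
    using W by (simp add: y_def inner_matrix_transpose[of z] psd_def inner_commute)
  moreover have "0 \<le> (z - w) \<bullet> (W *v (z - w))"
    using W by (simp add: psd_def)
  then have "0 \<le> z \<bullet> (W *v z) - z \<bullet> (W *v w) - w \<bullet> (W *v z) + w \<bullet> (W *v w)"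
    by (simp add: matrix_vector_mult_diff_distrib inner_diff_left inner_diff_right)
  ultimately show ?thesis
    by (simp add: inner_commute[of y] flip: y_def w_def)
qed

text \<open>The transformed sample lies in the orthogonal complement of \<open>u\<close>, which is
  the range of a singular \<open>W\<close> with kernel spanned by \<open>u\<close>. Regularizing
  \<open>W\<close> sends the determinant to 0 at bounded cost in the trace term.\<close>

lemma lhat_eq_infinity:
  fixes D :: "('n::finite \<times> 'n) set" and X :: "nat \<Rightarrow> real^'n"
  assumes C: "C \<in> bidi_components B"
    and v0: "\<And>i. i \<notin> Pa D C \<Longrightarrow> v $ i = 0" and nz: "\<And>i. i \<in> C \<Longrightarrow> v $ i \<noteq> 0"
    and orth: "\<And>s. s < n \<Longrightarrow> v \<bullet> X s = 0"
  shows "lhat D B (S0 n X) = \<infinity>"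
proof -
  define u where "u = coord_proj C v"
  have u: "u $ i \<noteq> 0 \<longleftrightarrow> i \<in> C" for i
    using nz by (auto simp: u_def coord_proj_def)
  moreover obtain i where "i \<in> C" using C by (auto simp: bidi_components_def)
  ultimately have "u \<noteq> 0" by fastforce
  obtain L where L: "L \<in> RD_reg D" and "(mat 1 - L) *v u = v"
    using RD_reg_map_coord_proj[OF v0 nz] unfolding u_def by blast
  define A where "A = mat 1 - L"
  define y where "y s = transpose A *v X s" for s
  have "y s \<bullet> u = 0" if "s < n" for s
    using orth[OF that] \<open>(mat 1 - L) *v u = v\<close>
    by (simp only: y_def A_def inner_matrix_transpose[symmetric]) (simp add: inner_commute)
  obtain W where W: "psd W" and W0: "\<And>i j. i \<noteq> j \<Longrightarrow> {i, j} \<notin> B \<Longrightarrow> W $ i $ j = 0"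
    and ker: "\<And>z. W *v z = 0 \<longleftrightarrow> z \<in> range (\<lambda>c. c *\<^sub>R u)"
    using ex_psd_kernel_span[OF C u] by blast
  have "\<forall>s. \<exists>z. s < n \<longrightarrow> W *v z = y s"
    using psd_range_orthogonal_kernel[OF W ker \<open>u \<noteq> 0\<close>] \<open>\<And>s. s < n \<Longrightarrow> y s \<bullet> u = 0\<close> by blast
  then obtain z where z: "\<And>s. s < n \<Longrightarrow> W *v z s = y s"
    by metis
  define G where "G \<epsilon> = W + \<epsilon> *\<^sub>R mat 1" for \<epsilon> :: real
  define Sig where "Sig \<epsilon> = transpose (matrix_inv A) ** G \<epsilon> ** matrix_inv A" for \<epsilon>
  \<comment> \<open>An upper bound for the trace term that is free of \<epsilon>.\<close>
  define b where "b = (\<Sum>s<n. z s \<bullet> (W *v z s)) / n"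
  define a where "a = (det A)\<^sup>2"
  have "a > 0"
    using L by (simp add: a_def A_def RD_reg_def invertible_det_nz)
  have G: "G \<epsilon> \<in> PD_B B" if "\<epsilon> > 0" for \<epsilon>
    using pos_def_psd_add_scaled_mat(1)[OF W that] W0 by (auto simp: G_def PD_B_def mat_def)
  have "det W = 0"
    using ker[of u] \<open>u \<noteq> 0\<close> by (metis invertible_det_nz invertible_left_inverse matrix_left_invertible_ker rangeI scaleR_one)
  have "isCont (\<lambda>\<epsilon>. det (G \<epsilon>)) 0"
    unfolding det_def G_def by (intro continuous_intros)
  then have lim: "((\<lambda>\<epsilon>. det (G \<epsilon>)) \<longlongrightarrow> 0) (at_right 0)"
    using \<open>det W = 0\<close> by (simp add: isCont_def G_def filterlim_at_split)
  have "ereal R \<le> lhat D B (S0 n X)" for R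
  proof -
    \<comment> \<open>Since \<open>det (Sig \<epsilon>) * a = det (G \<epsilon>)\<close>, this bound
      makes the determinant term exceed \<open>R + b\<close>; the trace term then costs at most
      \<open>b\<close>.\<close>
    have "eventually (\<lambda>\<epsilon>. det (G \<epsilon>) < a * exp (- (R + b))) (at_right 0)"
      using lim \<open>a > 0\<close> by (intro order_tendstoD) auto
    moreover have "eventually (\<lambda>\<epsilon>::real. \<epsilon> > 0) (at_right 0)"
      by (rule eventually_at_right_less)
    ultimately obtain \<epsilon> where \<epsilon>: "\<epsilon> > 0" "det (G \<epsilon>) < a * exp (- (R + b))"
      by (metis (mono_tags, lifting) eventually_conj eventually_happens trivial_limit_at_right_real)
    have Sig_G: "Sig \<epsilon> \<in> PD_G D B"
      using L G[OF \<epsilon>(1)] by (auto simp: PD_G_def Sig_def A_def)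
    have inv: "matrix_inv (Sig \<epsilon>) = A ** matrix_inv (G \<epsilon>) ** transpose A" "det (Sig \<epsilon>) * a = det (G \<epsilon>)"
      using PD_G_inverse_det[OF L G[OF \<epsilon>(1)] Sig_def[unfolded A_def]] by (simp_all add: A_def a_def)
    have "trace (matrix_inv (Sig \<epsilon>) ** S0 n X) = (\<Sum>s<n. y s \<bullet> (matrix_inv (G \<epsilon>) *v y s)) / n"
      unfolding trace_mult_S0 inv y_def
      using G[OF \<epsilon>(1)] by (simp only: psd_sandwich(2) psd_matrix_inv PD_B_def mem_Collect_eq)
    also have "\<dots> \<le> b"
      unfolding b_def
    proof (intro divide_right_mono sum_mono)
      fix s assume "s \<in> {..<n}"
      then show "y s \<bullet> (matrix_inv (G \<epsilon>) *v y s) \<le> z s \<bullet> (W *v z s)"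
        using regularized_inverse_quadratic_le[OF W \<epsilon>(1), of "z s"] z[of s] by (simp add: G_def)
    qed simp
    finally have tr: "trace (matrix_inv (Sig \<epsilon>) ** S0 n X) \<le> b" .
    have "a * det (Sig \<epsilon>) < a * exp (- (R + b))"
      using \<epsilon>(2) inv(2) by (simp add: mult.commute)
    then have "det (Sig \<epsilon>) < exp (- (R + b))"
      using \<open>a > 0\<close> by simp
    then have "ln (det (Sig \<epsilon>)) < - (R + b)"
      using PD_G_det_pos[OF Sig_G] by (metis exp_gt_zero ln_exp ln_less_cancel_iff)
    with tr have "R \<le> loglik (Sig \<epsilon>) (S0 n X)"
      by (simp add: loglik_def)
    then have "ereal R \<le> ereal (loglik (Sig \<epsilon>) (S0 n X))"
      by simp
    also have "\<dots> \<le> lhat D B (S0 n X)"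
      unfolding lhat_def by (intro SUP_upper Sig_G)
    finally show ?thesis .
  qed
  then show ?thesis
    by (rule ereal_top)
qed

section \<open>The value of the maximum likelihood threshold\<close>

theorem theorem3:
  fixes D :: "('n::finite \<times> 'n) set" and B :: "'n set set" and P :: "(real^'n) measure"
  assumes no_loops: "\<forall>i. (i, i) \<notin> D"
    and bidi_edges: "\<forall>e\<in>B. card e = 2"
    and prob: "prob_space P"
    and borel: "sets P = sets borel"
    and abs_cont: "absolutely_continuous lborel P"
  shows "mlt D B P = Max ((\<lambda>C. card (Pa D C)) ` bidi_components B)
    \<and> (\<forall>n < mlt D B P. AE X in sample_space n P. lhat D B (S0 n X) = \<infinity>)"
proof -
  let ?M = "Max ((\<lambda>C. card (Pa D C)) ` bidi_components B)"
  have comp_nonempty: "C \<noteq> {}" if "C \<in> bidi_components B" for C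
    using that by (auto simp: bidi_components_def)
  have fin: "finite ((\<lambda>C. card (Pa D C)) ` bidi_components B)"
    by simp
  have nonempty: "(\<lambda>C. card (Pa D C)) ` bidi_components B \<noteq> {}"
    by (auto simp: bidi_components_def)
  have le_Max: "card (Pa D C) \<le> ?M" if "C \<in> bidi_components B" for C
    using that fin by (intro Max_ge) auto
  obtain C where C: "C \<in> bidi_components B" and C_Max: "card (Pa D C) = ?M"
    using Max_in[OF fin nonempty] by (metis (no_types, lifting) imageE)
  \<comment> \<open>Positivity of the maximum excludes the empty sample from the finite case, where
    \<open>lhat_less_infinity\<close> asks for \<open>n > 0\<close>.\<close>
  have "Pa D C \<noteq> {}"
    using comp_nonempty[OF C] by (auto simp: Pa_def)
  then have "?M > 0"
    unfolding C_Max[symmetric] by (simp add: card_gt_0_iff)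
  have finite_above: "AE X in sample_space n P. lhat D B (S0 n X) < \<infinity>" if "n \<ge> ?M" for n
  proof -
    have "AE X in sample_space n P. \<forall>C\<in>bidi_components B. \<forall>y. (\<forall>i. i \<notin> Pa D C \<longrightarrow> y $ i = 0) \<longrightarrow>
        y \<in> span ((\<lambda>s. coord_proj (Pa D C) (X s)) ` {..<n})"
    proof (rule AE_finite_allI)
      fix C assume "C \<in> bidi_components B"
      then have "card (Pa D C) \<le> n"
        using le_Max that by (blast intro: order_trans)
      then show "AE X in sample_space n P. \<forall>y. (\<forall>i. i \<notin> Pa D C \<longrightarrow> y $ i = 0) \<longrightarrow>
          y \<in> span ((\<lambda>s. coord_proj (Pa D C) (X s)) ` {..<n})"
        by (rule AE_coord_proj_spans[OF prob borel abs_cont])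
    qed simp
    then show ?thesis
    proof eventually_elim
      case (elim X)
      show ?case
      proof (rule lhat_less_infinity)
        show "n > 0" using that \<open>?M > 0\<close> by (rule order.strict_trans2[rotated])
        fix C i assume C: "C \<in> bidi_components B"
        show "coord_proj (Pa D C) (axis i 1) \<in> span ((\<lambda>s. coord_proj (Pa D C) (X s)) ` {..<n})"
          by (rule elim[rule_format, OF C]) (simp add: coord_proj_def)
      qed
    qed
  qed
  have infinite_below: "AE X in sample_space n P. lhat D B (S0 n X) = \<infinity>" if "n < ?M" for n
  proof -
    \<comment> \<open>A single component attaining the maximum is enough to make the supremum
      infinite.\<close>
    have "C \<subseteq> Pa D C" by (auto simp: Pa_def)
    from AE_orthogonal_vector[OF prob borel abs_cont this that[folded C_Max]]
    show ?thesis
    proof eventually_elim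
      case (elim X)
      then obtain v where "\<forall>i. i \<notin> Pa D C \<longrightarrow> v $ i = 0" "\<forall>s<n. v \<bullet> X s = 0" "\<forall>i\<in>C. v $ i \<noteq> 0"
        by (elim exE conjE)
      then show ?case
        by (intro lhat_eq_infinity[OF C, of D v n X]) simp_all
    qed
  qed
  have "mlt D B P = ?M"
    unfolding mlt_def
  proof (rule Least_equality)
    show "\<forall>n\<ge>?M. AE X in sample_space n P. lhat D B (S0 n X) < \<infinity>"
      by (intro allI impI finite_above)
    fix N assume N: "\<forall>n\<ge>N. AE X in sample_space n P. lhat D B (S0 n X) < \<infinity>"
    \<comment> \<open>A smaller \<open>N\<close> would make the supremum almost surely both infinite
      and finite at sample size \<open>N\<close> itself, which is impossible in a probability
      space.\<close>
    show "?M \<le> N"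
    proof (rule ccontr)
      assume "\<not> ?M \<le> N"
      then have "AE X in sample_space N P. lhat D B (S0 N X) = \<infinity>"
        by (intro infinite_below) simp
      moreover have "AE X in sample_space N P. lhat D B (S0 N X) < \<infinity>"
        using N by simp
      ultimately have "AE X in sample_space N P. False"
        by eventually_elim simp
      moreover have "prob_space (sample_space N P)"
        by (intro prob_space_PiM prob)
      ultimately show False
        by (simp add: prob_space.AE_False)
    qed
  qed
  then show ?thesis
    using infinite_below by simp
qed

end
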